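(* Let $G$ be a finite simple graph and $T$ its toll walk transit function. Then $T$ satisfies Axioms (JC) and (pt) on $G$ if and only if $G$ is a Ptolemaic graph.
   Context: In a finite simple graph $G$, a walk $W=w_1w_2\cdots w_k$ ($k\ge 2$) is a toll walk if $w_1\neq w_k$, $w_2$ is the only neighbor of $w_1$ among the vertices of $W$, and $w_{k-1}$ is the only neighbor of $w_k$ among the vertices of $W$. The toll walk transit function $T$ of $G$ is given by $T(u,u)=\{u\}$ and, for $u\ne v$, $T(u,v)$ is the set of all vertices lying on some toll walk from $u$ to $v$. A graph is chordal if it has no induced cycle of length at least four; distance-hereditary if every induced path is a shortest path; Ptolemaic if it is both chordal and distance-hereditary (for connected graphs, equivalently, $d(u,v)d(w,x)+d(u,x)d(v,w)\ge d(u,w)d(v,x)$ for all vertices $u,v,w,x$). Axioms for $R=T$ on $V=V(G)$: (JC) For pairwise distinct $u,x,y,v$: if $x\in R(u,y)$, $y\in R(x,v)$ and $R(x,y)=\{x,y\}$, then $x\in R(u,v)$. (pt) For pairwise distinct $u,x,y,z,v$: if $x,z\in R(u,y)$, $y,z\in R(x,v)$ and $R(x,y)=\{x,y\}$, then $R(x,z)\neq\{x,z\}$ and $R(y,z)\neq\{y,z\}$. *)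

theory Defs
  imports "Graph_Theory.Graph_Theory"
begin

text \<open>Finite simple graphs are represented by the locale \<open>pair_graph\<close> (finite, symmetric, loop-free
  digraphs without parallel arcs), so that \<open>(x, y) \<in> parcs G\<close> says that \<open>x\<close> and \<open>y\<close> are adjacent.
  Walks and paths are the vertex lists \<open>vwalk\<close> and \<open>vpath\<close>.\<close>

text \<open>The uniqueness of the neighbors of the two ends concerns the vertices of the walk, not the
  positions at which they occur: the second vertex may occur again later in the walk.\<close>

definition toll_walk :: "'a pair_pre_digraph \<Rightarrow> 'a list \<Rightarrow> bool" where
  "toll_walk G W \<longleftrightarrow>
     vwalk W G \<and> 2 \<le> length W \<and> hd W \<noteq> last W \<and>
     {x \<in> set W. (hd W, x) \<in> parcs G} = {W ! 1} \<and>
     {x \<in> set W. (last W, x) \<in> parcs G} = {W ! (length W - 2)}"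

definition toll_transit :: "'a pair_pre_digraph \<Rightarrow> 'a \<Rightarrow> 'a \<Rightarrow> 'a set" where
  "toll_transit G u v =
     (if u = v then {u}
      else {x. \<exists>W. toll_walk G W \<and> hd W = u \<and> last W = v \<and> x \<in> set W})"

definition axiom_JC :: "'a set \<Rightarrow> ('a \<Rightarrow> 'a \<Rightarrow> 'a set) \<Rightarrow> bool" where
  "axiom_JC V R \<longleftrightarrow>
     (\<forall>u\<in>V. \<forall>x\<in>V. \<forall>y\<in>V. \<forall>v\<in>V.
        distinct [u, x, y, v] \<longrightarrow>
        x \<in> R u y \<longrightarrow> y \<in> R x v \<longrightarrow> R x y = {x, y} \<longrightarrow>
        x \<in> R u v)"

definition axiom_pt :: "'a set \<Rightarrow> ('a \<Rightarrow> 'a \<Rightarrow> 'a set) \<Rightarrow> bool" where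
  "axiom_pt V R \<longleftrightarrow>
     (\<forall>u\<in>V. \<forall>x\<in>V. \<forall>y\<in>V. \<forall>z\<in>V. \<forall>v\<in>V.
        distinct [u, x, y, z, v] \<longrightarrow>
        x \<in> R u y \<longrightarrow> z \<in> R u y \<longrightarrow> y \<in> R x v \<longrightarrow> z \<in> R x v \<longrightarrow>
        R x y = {x, y} \<longrightarrow>
        R x z \<noteq> {x, z} \<and> R y z \<noteq> {y, z})"

text \<open>A cycle is given by the list of its vertices in cyclic order, without repeating the first one
  at the end.  It is induced if the only adjacencies between its vertices are those between
  cyclically consecutive ones.\<close>

definition induced_cycle :: "'a pair_pre_digraph \<Rightarrow> 'a list \<Rightarrow> bool" where
  "induced_cycle G c \<longleftrightarrow>
     3 \<le> length c \<and> distinct c \<and> set c \<subseteq> pverts G \<and>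
     (\<forall>i<length c. \<forall>j<length c.
        (c ! i, c ! j) \<in> parcs G \<longleftrightarrow> j = Suc i mod length c \<or> i = Suc j mod length c)"

definition chordal :: "'a pair_pre_digraph \<Rightarrow> bool" where
  "chordal G \<longleftrightarrow> \<not> (\<exists>c. induced_cycle G c \<and> 4 \<le> length c)"

definition induced_path :: "'a pair_pre_digraph \<Rightarrow> 'a list \<Rightarrow> bool" where
  "induced_path G p \<longleftrightarrow>
     vpath p G \<and>
     (\<forall>i<length p. \<forall>j<length p.
        (p ! i, p ! j) \<in> parcs G \<longrightarrow> j = Suc i \<or> i = Suc j)"

definition shortest_path :: "'a pair_pre_digraph \<Rightarrow> 'a list \<Rightarrow> bool" where
  "shortest_path G p \<longleftrightarrow>
     vpath p G \<and>
     (\<forall>q. vpath q G \<and> hd q = hd p \<and> last q = last p \<longrightarrow> vwalk_length p \<le> vwalk_length q)"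

text \<open>As only vertices joined by a path are compared, disconnected graphs are included.\<close>

definition distance_hereditary :: "'a pair_pre_digraph \<Rightarrow> bool" where
  "distance_hereditary G \<longleftrightarrow> (\<forall>p. induced_path G p \<longrightarrow> shortest_path G p)"

definition ptolemaic :: "'a pair_pre_digraph \<Rightarrow> bool" where
  "ptolemaic G \<longleftrightarrow> chordal G \<and> distance_hereditary G"

end

theory Submission
  imports Defs
begin

text \<open>Both sides are equivalent to \<open>G\<close> being chordal and gem-free.  The workhorse is that in a chordal
  graph an edge of a cycle spans a triangle with a third vertex of the cycle.  If \<open>x \<in> T(u, y)\<close> and \<open>xy\<close>
  is an edge, a toll walk through \<open>x\<close> restricts to a walk from \<open>u\<close> to \<open>x\<close> that meets the neighborhood
  of \<open>y\<close> only in \<open>x\<close>; the premises of the axioms supply such walks on both sides of \<open>xy\<close>.  For (JC) they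
  cannot touch each other, so they join to a toll walk from \<open>u\<close> to \<open>v\<close>.  For (pt), the triangles
  forced on the edges of the triangle \<open>xyz\<close> form a gem with center \<open>z\<close>.  Conversely, a long induced cycle
  violates (JC) and a gem violates (pt).\<close>

section \<open>Cutting segments out of walks\<close>

lemma successively_take: "successively P xs \<Longrightarrow> successively P (take n xs)"
  by (metis append_take_drop_id successively_append_iff)

lemma successively_drop: "successively P xs \<Longrightarrow> successively P (drop n xs)"
  by (metis append_take_drop_id successively_append_iff)

lemma last_take_Suc: "i < length w \<Longrightarrow> last (take (Suc i) w) = w ! i"
  by (simp add: take_Suc_conv_app_nth)

text \<open>Only the junction between the two pieces needs checking. For \<open>i = 0\<close> there
  is no junction, hence the guard on the last premise.\<close>

lemma successively_take_drop:
  assumes "successively P w" "i \<le> length w" "j < length w" "0 < i \<Longrightarrow> P (w ! (i - 1)) (w ! j)"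
  shows "successively P (take i w @ drop j w)"
  using assms
  by (cases i) (auto simp: successively_append_iff successively_take successively_drop
      last_take_Suc hd_drop_conv_nth Suc_le_eq)

text \<open>The five vertices of such a configuration are automatically distinct in a loop-free graph.\<close>

definition gem_free :: "'a pair_pre_digraph \<Rightarrow> bool" where
  "gem_free G \<longleftrightarrow> (\<forall>a b c d z.
     {(a, b), (b, c), (c, d), (a, z), (b, z), (c, z), (d, z)} \<subseteq> parcs G \<longrightarrow>
     (a, c) \<in> parcs G \<or> (b, d) \<in> parcs G \<or> (a, d) \<in> parcs G)"

section \<open>Adjacency, walks and induced cycles\<close>

context pair_graph
begin

abbreviation adj :: "'a \<Rightarrow> 'a \<Rightarrow> bool" where
  "adj x y \<equiv> (x, y) \<in> parcs G"

lemma adj_sym: "adj x y \<Longrightarrow> adj y x"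
  using pair_sym_arcs by (auto simp: symmetric_def elim: symE)

lemma adj_commute: "adj x y \<longleftrightarrow> adj y x"
  using adj_sym by blast

lemma adj_irrefl: "\<not> adj x x"
  using pair_no_loops by fastforce

lemma successively_adj_rev [simp]: "successively adj (rev w) \<longleftrightarrow> successively adj w"
  by (simp add: adj_commute)

lemma successively_adj_set: "successively adj w \<Longrightarrow> 2 \<le> length w \<Longrightarrow> set w \<subseteq> pverts G"
proof (induction w rule: induct_list012)
  case (3 a b w)
  then show ?case by (cases w) (auto dest: in_arcsD1 in_arcsD2)
qed auto

lemma vwalk_iff:
  "vwalk w G \<longleftrightarrow> w \<noteq> [] \<and> set w \<subseteq> pverts G \<and> successively adj w"
proof -
  have "set (vwalk_arcs w) \<subseteq> parcs G \<longleftrightarrow> successively adj w"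
    by (induct w rule: vwalk_arcs.induct) auto
  then show ?thesis
    by (auto simp: vwalk_def)
qed

text \<open>Adjacency is symmetric and irreflexive, so pairs \<open>i < j\<close> suffice; for these
  the modular condition splits into consecutive positions and the closing edge.\<close>

lemma induced_cycle_iff:
  "induced_cycle G c \<longleftrightarrow> 3 \<le> length c \<and> distinct c \<and> set c \<subseteq> pverts G \<and>
     (\<forall>i j. i < j \<and> j < length c \<longrightarrow>
        (adj (c ! i) (c ! j) \<longleftrightarrow> j = Suc i \<or> i = 0 \<and> Suc j = length c))"
  (is "_ \<longleftrightarrow> ?R")
proof
  assume "induced_cycle G c"
  then show ?R
    unfolding induced_cycle_def by (auto simp: mod_Suc split: if_splits)
next
  assume R: ?R
  have "adj (c ! i) (c ! j) \<longleftrightarrow> j = Suc i mod length c \<or> i = Suc j mod length c"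
    if ij: "i < length c" "j < length c" for i j
  proof (cases i j rule: linorder_cases)
    case less
    then show ?thesis using R ij by (auto simp: mod_Suc)
  next
    case equal
    then show ?thesis using R ij by (auto simp: mod_Suc adj_irrefl)
  next
    case greater
    then have "adj (c ! j) (c ! i) \<longleftrightarrow> i = Suc j \<or> j = 0 \<and> Suc i = length c"
      using R ij by blast
    then show ?thesis using R ij greater by (subst adj_commute) (auto simp: mod_Suc)
  qed
  with R show "induced_cycle G c"
    by (simp add: induced_cycle_def)
qed

section \<open>Triangles on the edges of cycles in chordal graphs\<close>

text \<open>In a shortest counterexample any chord or repeated vertex would allow a shorter walk on
  the same vertices, so \<open>x # w @ [y]\<close> is an induced cycle of length at least four.
  Allowing walks instead of paths spares the users any check of distinctness.\<close>

lemma chordal_common_neighbor: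
  assumes "chordal G" and xy: "adj x y"
    and "successively adj w" "w \<noteq> []" "adj x (hd w)" "adj (last w) y" "x \<notin> set w" "y \<notin> set w"
  shows "\<exists>z\<in>set w. adj x z \<and> adj z y"
  using assms(3-)
proof (induction w rule: length_induct)
  case (1 w)
  note w = "1.prems"
  show ?case
  proof (rule ccontr)
    assume no: "\<not> ?thesis"
    \<comment> \<open>The induction hypothesis would give a common neighbor on \<open>w'\<close>,
      which also lies on \<open>w\<close>.\<close>
    have minimal: False
      if "length w' < length w" "set w' \<subseteq> set w" "successively adj w'" "w' \<noteq> []"
        "adj x (hd w')" "adj (last w') y" for w'
      using "1.IH"[rule_format, of w'] that w no by blast
    have shortcut: False
      if "i < length w" "j < length w" "Suc i < j" "adj (w ! i) (w ! j)" for i j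
    proof (rule minimal[of "take (Suc i) w @ drop j w"])
      show "set (take (Suc i) w @ drop j w) \<subseteq> set w"
        using set_take_subset[of "Suc i" w] set_drop_subset[of j w] by auto
      show "successively adj (take (Suc i) w @ drop j w)"
        using w that by (intro successively_take_drop) auto
    qed (use that w in auto)
    \<comment> \<open>At a repeated vertex the closed detour from position \<open>i\<close> to
      \<open>j\<close> is cut out; for \<open>i = 0\<close> the walk then starts at
      \<open>w ! j\<close>, the same vertex.\<close>
    have rep: "w ! i \<noteq> w ! j" if "i < j" "j < length w" for i j
    proof
      assume eq: "w ! i = w ! j"
      show False
      proof (rule minimal[of "take i w @ drop j w"])
        show "set (take i w @ drop j w) \<subseteq> set w"
          using set_take_subset[of i w] set_drop_subset[of j w] by auto
        have "adj (w ! k) (w ! j)" if "i = Suc k" for k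
          using eq \<open>i < j\<close> \<open>j < length w\<close> w(1) that
          by (metis order_less_trans successively_nth)
        then show "successively adj (take i w @ drop j w)"
          using w that by (intro successively_take_drop) (auto simp: gr0_conv_Suc)
        show "adj x (hd (take i w @ drop j w))"
          using w that eq by (cases i) (auto simp: hd_drop_conv_nth hd_conv_nth nth_append)
      qed (use that w in auto)
    qed
    have nx: "\<not> adj x (w ! i)" if "0 < i" "i < length w" for i
    proof
      assume "adj x (w ! i)"
      then show False
        using that w set_drop_subset[of i w]
        by (intro minimal[of "drop i w"]) (auto simp: successively_drop hd_drop_conv_nth)
    qed
    have ny: "\<not> adj (w ! i) y" if "Suc i < length w" for i
    proof
      assume "adj (w ! i) y"
      then show False
        using that w set_take_subset[of "Suc i" w]
        by (intro minimal[of "take (Suc i) w"])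
          (auto simp: successively_take last_take_Suc)
    qed
    \<comment> \<open>A single vertex would be adjacent to both \<open>x\<close> and
      \<open>y\<close>. Hence the cycle below has at least four vertices.\<close>
    have "length w \<noteq> 1"
      using no w by (auto simp: length_Suc_conv)
    with w have len: "2 \<le> length w"
      by (simp add: numeral_2_eq_2 Suc_le_eq nat_neq_iff)
    let ?c = "x # w @ [y]"
    have "induced_cycle G ?c"
      unfolding induced_cycle_iff
    proof (intro conjI allI impI)
      show "3 \<le> length ?c" using len by simp
      have "distinct w"
        unfolding distinct_conv_nth using rep by (metis linorder_neqE_nat)
      then show "distinct ?c"
        using w xy adj_irrefl by auto
      show "set ?c \<subseteq> pverts G"
        using successively_adj_set[OF w(1) len] xy in_arcsD1 in_arcsD2 by auto
      fix i j
      assume ij: "i < j \<and> j < length ?c"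
      \<comment> \<open>Positions in \<open>?c\<close> are shifted by one against \<open>w\<close>,
        and \<open>y\<close> follows the last vertex of \<open>w\<close>.\<close>
      have nth: "?c ! Suc k = (if k = length w then y else w ! k)" if "k \<le> length w" for k
        using that by (simp add: nth_append)
      show "adj (?c ! i) (?c ! j) \<longleftrightarrow> j = Suc i \<or> i = 0 \<and> Suc j = length ?c"
      proof (cases i)
        case 0
        then obtain l where l: "j = Suc l" "l \<le> length w"
          using ij by (cases j) auto
        then show ?thesis
          using 0 nth[of l] xy w nx[of l] by (cases "l = 0") (auto simp: hd_conv_nth)
      next
        case (Suc k)
        then obtain l where l: "j = Suc l" "l \<le> length w" "k < l"
          using ij by (cases j) auto
        show ?thesis
        proof (cases "l = length w")
          case True
          then show ?thesis
            using Suc l w ny[of k] nth[of k] nth[of l]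
            by (auto simp: last_conv_nth) (metis Suc_lessI diff_Suc_1)
        next
          case False
          then show ?thesis
            using Suc l w shortcut[of k l] nth[of k] nth[of l] successively_nth[OF w(1), of k]
            by (cases "l = Suc k") auto
        qed
      qed
    qed
    then show False
      using \<open>chordal G\<close> len by (auto simp: chordal_def)
  qed
qed


lemma gem_freeD:
  assumes "gem_free G" "adj a b" "adj b c" "adj c d" "adj a z" "adj b z" "adj c z" "adj d z"
  shows "adj a c \<or> adj b d \<or> adj a d"
  using assms unfolding gem_free_def by simp blast

section \<open>Toll walks and the transit function\<close>

lemma toll_walk_rev: "toll_walk G W \<Longrightarrow> toll_walk G (rev W)"
  by (auto simp: toll_walk_def vwalk_iff hd_rev last_rev rev_nth numeral_2_eq_2
      simp del: successively_rev)

lemma toll_walk_neighbor_unique: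
  assumes "toll_walk G W" "e = hd W \<or> e = last W" "a \<in> set W" "adj e a" "b \<in> set W" "adj e b"
  shows "a = b"
  using assms unfolding toll_walk_def by (smt (verit) mem_Collect_eq singletonD)

lemma toll_transit_commute: "toll_transit G x y = toll_transit G y x"
proof -
  have "toll_transit G x y \<subseteq> toll_transit G y x" for x y
  proof (cases "x = y")
    case False
    then show ?thesis
      by (auto simp: toll_transit_def) (metis hd_rev last_rev set_rev toll_walk_rev)
  qed simp
  then show ?thesis by blast
qed

text \<open>In a toll walk between adjacent ends, each end is the only neighbor of the other one, so
  the walk can only alternate between the two.\<close>

lemma toll_transit_adj:
  assumes "adj x y"
  shows "toll_transit G x y = {x, y}"
proof -
  have neq: "x \<noteq> y" using assms adj_irrefl by auto
  have "toll_walk G [x, y]"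
    using assms neq by (auto simp: toll_walk_def vwalk_iff adj_irrefl in_arcsD1 in_arcsD2 adj_sym)
  have "W ! i \<in> {x, y}"
    if W: "toll_walk G W" "hd W = x" "last W = y" and "i < length W" for W i
    using \<open>i < length W\<close>
  proof (induction i)
    case 0
    then show ?case using W by (auto simp: hd_conv_nth)
  next
    case (Suc i)
    then have "adj (W ! i) (W ! Suc i)"
      using W by (auto simp: toll_walk_def vwalk_iff intro: successively_nth)
    moreover have "x \<in> set W" "y \<in> set W"
      using W by (auto simp: toll_walk_def vwalk_iff)
    then have "a = y" if "a \<in> set W" "adj x a" for a
      using toll_walk_neighbor_unique[OF W(1), of x a y] that W assms by simp
    moreover have "a = x" if "a \<in> set W" "adj y a" for a
      using toll_walk_neighbor_unique[OF W(1), of y a x] that W adj_sym[OF assms] \<open>x \<in> set W\<close>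
      by simp
    moreover have "W ! Suc i \<in> set W" "W ! i \<in> {x, y}"
      using Suc by auto
    ultimately show ?case
      by auto
  qed
  then have "set W \<subseteq> {x, y}" if "toll_walk G W" "hd W = x" "last W = y" for W
    using that unfolding in_set_conv_nth subset_iff by blast
  then have "toll_transit G x y \<subseteq> {x, y}"
    using neq by (auto simp: toll_transit_def)
  moreover have "{x, y} \<subseteq> toll_transit G x y"
    using \<open>toll_walk G [x, y]\<close> neq by (auto simp: toll_transit_def intro!: exI[of _ "[x, y]"])
  ultimately show ?thesis by blast
qed

text \<open>This translates the premise on \<open>R x y\<close> in both axioms. Conversely to the
  previous lemma, the second vertex of a toll walk inside \<open>{x, y}\<close> is a neighbor of
  \<open>x\<close>, hence \<open>y\<close>.\<close>

lemma toll_transit_eq_pair_iff: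
  assumes "x \<noteq> y"
  shows "toll_transit G x y = {x, y} \<longleftrightarrow> adj x y"
proof
  assume T: "toll_transit G x y = {x, y}"
  then have "x \<in> toll_transit G x y" by simp
  then obtain W where W: "toll_walk G W" "hd W = x" "last W = y"
    using assms by (auto simp: toll_transit_def)
  then have "W ! 1 \<in> {a \<in> set W. adj x a}"
    by (auto simp: toll_walk_def)
  moreover have "set W \<subseteq> {x, y}"
    using W T assms by (auto simp: toll_transit_def)
  ultimately show "adj x y"
    using adj_irrefl by auto
qed (rule toll_transit_adj)

text \<open>The second and the last but one vertex are neighbors of the ends because the walk steps
  along edges, so only their uniqueness has to be supplied.\<close>

lemma toll_transitI:
  assumes "successively adj W" "2 \<le> length W" "hd W \<noteq> last W"
    "\<And>a. a \<in> set W \<Longrightarrow> adj (hd W) a \<Longrightarrow> a = W ! 1"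
    "\<And>a. a \<in> set W \<Longrightarrow> adj (last W) a \<Longrightarrow> a = W ! (length W - 2)"
    "x \<in> set W"
  shows "x \<in> toll_transit G (hd W) (last W)"
proof -
  have "adj (hd W) (W ! 1)"
    using assms by (cases W) (auto simp: successively_Cons hd_conv_nth Suc_le_eq)
  moreover have "adj (last W) (W ! (length W - 2))"
  proof -
    have "Suc (length W - 2) = length W - 1" using assms(2) by simp
    then show ?thesis
      using successively_nth[OF assms(1), of "length W - 2"] assms(2)
      by (simp add: last_conv_nth adj_commute flip: length_greater_0_conv)
  qed
  moreover have "vwalk W G"
    using assms successively_adj_set by (auto simp: vwalk_iff)
  moreover have "W ! 1 \<in> set W" "W ! (length W - 2) \<in> set W"
    using assms(2) by auto
  ultimately have "toll_walk G W"
    using assms by (auto simp: toll_walk_def)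
  then show ?thesis
    using assms by (auto simp: toll_transit_def)
qed

text \<open>The induced path \<open>[x, y, z]\<close> is itself a toll walk; it provides the transit
  premises inside gems and long cycles.\<close>

lemma toll_transit_middle:
  assumes "adj x y" "adj y z" "x \<noteq> z" "\<not> adj x z"
  shows "y \<in> toll_transit G x z"
proof -
  have "y \<in> toll_transit G (hd [x, y, z]) (last [x, y, z])"
    using assms adj_sym[of z x] by (intro toll_transitI) (auto simp: adj_irrefl)
  then show ?thesis by simp
qed

section \<open>Walks on the two sides of the edge, and (JC) in chordal graphs\<close>

text \<open>The toll walk is cut at its first visit to \<open>x\<close>. As \<open>x\<close> is the
  only neighbor of \<open>y\<close> on the walk, nothing earlier is adjacent to \<open>y\<close>;
  the last clause keeps the toll condition at \<open>u\<close>.\<close>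

lemma toll_transit_prefix:
  assumes "x \<in> toll_transit G u y" "adj x y" "u \<noteq> x" "u \<noteq> y"
  obtains p where "p \<noteq> []" "hd p = u" "successively adj (p @ [x])" "x \<notin> set p" "y \<notin> set p"
    "\<forall>a\<in>set p. \<not> adj a y" "\<And>a. a \<in> insert x (set p) \<Longrightarrow> adj u a \<Longrightarrow> a = (p @ [x]) ! 1"
proof -
  obtain W where W: "toll_walk G W" "hd W = u" "last W = y" "x \<in> set W"
    using assms by (auto simp: toll_transit_def)
  then have y: "a = x" if "a \<in> set W" "adj a y" for a
    using that W \<open>adj x y\<close> toll_walk_neighbor_unique adj_sym by metis
  obtain p r where p: "W = p @ x # r" "x \<notin> set p"
    using W by (meson split_list_first)
  then have "p \<noteq> []" using W assms by auto
  moreover have succ: "successively adj (p @ [x])"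
    using W p by (auto simp: toll_walk_def vwalk_iff successively_append_iff)
  moreover have "\<forall>a\<in>set p. \<not> adj a y"
    using y p by auto
  \<comment> \<open>A toll walk may visit \<open>y\<close> before its end, but the predecessor of
    such a visit would be a neighbor of \<open>y\<close>, hence \<open>x\<close>, which does not
    occur in \<open>p\<close>.\<close>
  moreover have "y \<notin> set p"
  proof
    assume "y \<in> set p"
    then obtain p1 p2 where p12: "p = p1 @ y # p2" by (meson split_list)
    then have "p1 \<noteq> []" using W p assms by auto
    moreover from this have "adj (last p1) y"
      using succ p12 by (auto simp: successively_append_iff)
    ultimately show False
      using y[of "last p1"] p p12 by auto
  qed
  moreover have "a = (p @ [x]) ! 1" if "a \<in> insert x (set p)" "adj u a" for a
  proof -
    have "a \<in> {a \<in> set W. adj u a}" using that p by auto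
    then have "a = W ! 1" using W by (auto simp: toll_walk_def)
    then show ?thesis using p \<open>p \<noteq> []\<close> by (auto simp: nth_append Suc_le_eq less_Suc_eq_0_disj)
  qed
  ultimately show thesis
    using that p W by (metis hd_append2)
qed

text \<open>Any contact between \<open>p\<close> and \<open>q\<close> closes a cycle through the edge \<open>xy\<close>, which is then in no
  triangle of that cycle.\<close>

lemma chordal_no_contact:
  assumes "chordal G" "adj x y"
    and p: "successively adj (p @ [x])" "x \<notin> set p" "y \<notin> set p" "\<And>a. a \<in> set p \<Longrightarrow> \<not> adj a y"
    and q: "successively adj (q @ [y])" "x \<notin> set q" "y \<notin> set q" "\<And>b. b \<in> set q \<Longrightarrow> \<not> adj b x"
    and "a \<in> set p" "b \<in> set q"
  shows "a \<noteq> b \<and> \<not> adj a b"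
proof (rule ccontr)
  assume ab: "\<not> ?thesis"
  obtain p1 p2 where p12: "p = p1 @ a # p2" using \<open>a \<in> set p\<close> by (meson split_list)
  obtain q1 q2 where q12: "q = q1 @ b # q2" using \<open>b \<in> set q\<close> by (meson split_list)
  \<comment> \<open>The closing walk runs back along \<open>p\<close> to \<open>a\<close> and then
    from \<open>b\<close> along \<open>q\<close>. If \<open>a = b\<close>, this vertex is kept only
    once.\<close>
  define p' where "p' = (if a = b then p2 else a # p2)"
  have "adj (last p) x"
    using p(1) \<open>a \<in> set p\<close> by (auto simp: successively_append_iff)
  then have "adj x (last (a # p2))"
    using p12 adj_sym by simp
  then have "adj x (hd (rev p' @ b # q2))"
    using ab by (auto simp: p'_def hd_append hd_rev)
  moreover have "successively adj (rev p' @ b # q2)"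
    using p q p12 q12 ab
    by (auto simp: p'_def successively_append_iff successively_Cons last_rev adj_commute hd_append
        split: if_splits)
  moreover have "adj (last q) y"
    using q(1) \<open>b \<in> set q\<close> by (auto simp: successively_append_iff)
  then have "adj (last (rev p' @ b # q2)) y"
    using q12 by simp
  moreover have "set (rev p' @ b # q2) \<subseteq> set p \<union> set q"
    using p12 q12 by (auto simp: p'_def)
  \<comment> \<open>Such a \<open>z\<close> is impossible: vertices of \<open>p\<close> are not
    adjacent to \<open>y\<close>, those of \<open>q\<close> not to \<open>x\<close>.\<close>
  ultimately obtain z where "z \<in> set p \<union> set q" "adj x z" "adj z y"
    using chordal_common_neighbor[OF \<open>chordal G\<close> \<open>adj x y\<close>, of "rev p' @ b # q2"] p q by blast
  then show False
    using p q adj_sym by blast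
qed

text \<open>The walk from \<open>u\<close> to \<open>x\<close>, the edge \<open>xy\<close> and the
  reversed walk from \<open>v\<close> to \<open>y\<close> form a toll walk: \<open>u\<close> has no
  neighbor in \<open>q\<close> by absence of contact and is not adjacent to \<open>y\<close>, so its
  neighbors remain those in the first part; likewise for \<open>v\<close>.\<close>

lemma chordal_imp_JC:
  assumes "chordal G"
  shows "axiom_JC (pverts G) (toll_transit G)"
  unfolding axiom_JC_def
proof (intro ballI impI)
  fix u x y v
  assume d: "distinct [u, x, y, v]" and x: "x \<in> toll_transit G u y" and y: "y \<in> toll_transit G x v"
    and "toll_transit G x y = {x, y}"
  then have xy: "adj x y" by (simp add: toll_transit_eq_pair_iff)
  obtain p where p: "p \<noteq> []" "hd p = u" "successively adj (p @ [x])" "x \<notin> set p" "y \<notin> set p"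
    "\<forall>a\<in>set p. \<not> adj a y" "\<And>a. a \<in> insert x (set p) \<Longrightarrow> adj u a \<Longrightarrow> a = (p @ [x]) ! 1"
    using toll_transit_prefix[OF x xy] d by auto
  have "y \<in> toll_transit G v x" using y toll_transit_commute by blast
  then obtain q where q: "q \<noteq> []" "hd q = v" "successively adj (q @ [y])" "y \<notin> set q" "x \<notin> set q"
    "\<forall>a\<in>set q. \<not> adj a x" "\<And>a. a \<in> insert y (set q) \<Longrightarrow> adj v a \<Longrightarrow> a = (q @ [y]) ! 1"
    using toll_transit_prefix[OF _ adj_sym[OF xy]] d by auto
  have pq: "a \<noteq> b \<and> \<not> adj a b" if "a \<in> set p" "b \<in> set q" for a b
    using chordal_no_contact[OF assms xy p(3,4,5) _ q(3,5,4)] p(6) q(6) that by blast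
  have uv: "u \<in> set p" "v \<in> set q" using p q by auto
  let ?W = "p @ x # y # rev q"
  have "hd ?W = u" "last ?W = v" using p q by (auto simp: last_rev)
  moreover have "successively adj ?W"
    using p q xy by (auto simp: successively_append_iff successively_Cons hd_rev adj_commute)
  moreover have "a = ?W ! 1" if "a \<in> set ?W" "adj u a" for a
  proof -
    have "a \<in> insert x (set p)"
      using that uv p(6) pq by auto
    then have "a = (p @ [x]) ! 1" using p that by blast
    then show ?thesis using p by (auto simp: nth_append Suc_le_eq less_Suc_eq_0_disj)
  qed
  moreover have "a = ?W ! (length ?W - 2)" if "a \<in> set ?W" "adj v a" for a
  proof -
    have "a \<in> insert y (set q)"
      using that uv bspec[OF q(6) uv(2)] pq[of a v] adj_sym[of v a] by auto
    then have "a = (q @ [y]) ! 1" using q that by blast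
    \<comment> \<open>The last but one vertex is the second one of the reversed walk, which begins
      with \<open>q @ [y]\<close>.\<close>
    moreover have "?W ! (length ?W - 2) = rev ?W ! 1"
      using q by (subst rev_nth) (auto simp: numeral_2_eq_2)
    ultimately show ?thesis
      using q by (auto simp: nth_append Suc_le_eq less_Suc_eq_0_disj)
  qed
  ultimately show "x \<in> toll_transit G u v"
    using toll_transitI[of ?W x] d by auto
qed

section \<open>Axiom (pt) in chordal gem-free graphs\<close>

text \<open>Two walks with a common start are glued there by reversing the first; \<open>tl\<close>
  keeps the common vertex from appearing twice.\<close>

lemma successively_adj_join:
  assumes "p \<noteq> []" "q \<noteq> []" "hd p = hd q" "successively adj p" "successively adj q"
  shows "successively adj (rev p @ tl q)" "hd (rev p @ tl q) = last p" "last (rev p @ tl q) = last q"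
    "set (rev p @ tl q) = set p \<union> set q"
proof -
  obtain a q' where q: "q = a # q'" using \<open>q \<noteq> []\<close> by (cases q) auto
  then have "last (rev p) = a" "a \<in> set p"
    using assms by (auto simp: last_rev hd_in_set)
  moreover have "successively adj (rev p)"
    using assms successively_adj_rev by blast
  ultimately show "successively adj (rev p @ tl q)" "hd (rev p @ tl q) = last p"
    "last (rev p @ tl q) = last q" "set (rev p @ tl q) = set p \<union> set q"
    using assms q
    by (auto simp: successively_append_iff successively_Cons hd_rev simp del: successively_rev)
qed

text \<open>If \<open>xz\<close> is an edge, the walks from \<open>v\<close> force the edge
  \<open>zy\<close>. Then the walks from \<open>u\<close> give a common neighbor \<open>a\<close> of
  \<open>x\<close> and \<open>z\<close>, those from \<open>v\<close> a common neighbor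
  \<open>b\<close> of \<open>y\<close> and \<open>z\<close>, and the path \<open>a\<close>,
  \<open>x\<close>, \<open>y\<close>, \<open>b\<close> with center \<open>z\<close> is a
  gem.\<close>

lemma chordal_gem_free_no_triangle:
  assumes "chordal G" "gem_free G" and d: "distinct [u, x, y, z, v]"
    and T: "x \<in> toll_transit G u y" "z \<in> toll_transit G u y"
      "y \<in> toll_transit G x v" "z \<in> toll_transit G x v"
    and xy: "adj x y"
  shows "\<not> adj x z"
proof
  assume xz: "adj x z"
  have T': "y \<in> toll_transit G v x" "z \<in> toll_transit G v x" using T toll_transit_commute by blast+
  have ne: "u \<noteq> x" "u \<noteq> y" "u \<noteq> z" "v \<noteq> x" "v \<noteq> y" "v \<noteq> z" using d by auto
  note yx = adj_sym[OF xy] note zx = adj_sym[OF xz]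
  obtain q where q: "q \<noteq> []" "hd q = v" "successively adj (q @ [y])" "y \<notin> set q" "x \<notin> set q"
    "\<forall>a\<in>set q. \<not> adj a x"
    by (rule toll_transit_prefix[OF T'(1) yx ne(5,4)]) (rule that)
  obtain r where r: "r \<noteq> []" "hd r = v" "successively adj (r @ [z])" "z \<notin> set r" "x \<notin> set r"
    "\<forall>a\<in>set r. \<not> adj a x"
    by (rule toll_transit_prefix[OF T'(2) zx ne(6,4)]) (rule that)
  have lasts: "adj (last q) y" "adj (last r) z"
    using q r by (auto simp: successively_append_iff)
  have succs: "successively adj q" "successively adj r"
    using q r by (auto simp: successively_append_iff)
  note qr = successively_adj_join[OF q(1) r(1) _ succs]
  \<comment> \<open>Both \<open>y\<close> and \<open>z\<close> are neighbors of \<open>x\<close>,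
    and \<open>q\<close> and \<open>r\<close> contain none.\<close>
  have yr: "y \<notin> set r" and zq: "z \<notin> set q" using q r yx zx by auto
  have zy: "adj z y"
  proof -
    let ?w = "z # rev r @ tl q"
    note rq = successively_adj_join[OF r(1) q(1) _ succs(2,1)]
    have "successively adj ?w" "last ?w = last q"
      using rq q r lasts by (auto simp: successively_Cons adj_commute)
    moreover have "set ?w = insert z (set r \<union> set q)" using rq q r by auto
    \<comment> \<open>Vertices of \<open>q\<close> and \<open>r\<close> are not adjacent to
      \<open>x\<close>, so the third vertex \<open>t\<close> must be \<open>z\<close>.\<close>
    ultimately obtain t where "t \<in> insert z (set r \<union> set q)" "adj x t" "adj t y"
      using chordal_common_neighbor[OF \<open>chordal G\<close> xy, of ?w] xz lasts q r yr d by auto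
    then show ?thesis using q r adj_sym by blast
  qed
  obtain p where p: "p \<noteq> []" "hd p = u" "successively adj (p @ [x])" "x \<notin> set p" "y \<notin> set p"
    "\<forall>a\<in>set p. \<not> adj a y"
    by (rule toll_transit_prefix[OF T(1) xy ne(1,2)]) (rule that)
  \<comment> \<open>The edge \<open>zy\<close> just found is what allows cutting the walk from
    \<open>u\<close> to \<open>y\<close> at \<open>z\<close>.\<close>
  obtain s where s: "s \<noteq> []" "hd s = u" "successively adj (s @ [z])" "z \<notin> set s" "y \<notin> set s"
    "\<forall>a\<in>set s. \<not> adj a y"
    by (rule toll_transit_prefix[OF T(2) zy ne(3,2)]) (rule that)
  have lasts': "adj (last p) x" "adj (last s) z"
    using p s by (auto simp: successively_append_iff)
  have succs': "successively adj p" "successively adj s"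
    using p s by (auto simp: successively_append_iff)
  note ps = successively_adj_join[OF p(1) s(1) _ succs']
  have "x \<notin> set s" "z \<notin> set p" using p s xy zy by auto
  then obtain a where a: "a \<in> set p \<union> set s" "adj x a" "adj a z"
    using chordal_common_neighbor[OF \<open>chordal G\<close> xz, of "rev p @ tl s"] ps p s
      adj_sym[OF lasts'(1)] lasts'(2) by auto
  then have ay: "\<not> adj a y" using p s by auto
  obtain b where b: "b \<in> set q \<union> set r" "adj y b" "adj b z"
    using chordal_common_neighbor[OF \<open>chordal G\<close> adj_sym[OF zy], of "rev q @ tl r"] qr q r yr zq
      adj_sym[OF lasts(1)] lasts(2) by auto
  then have bx: "\<not> adj b x" using q r by auto
  have "x \<notin> {a, b}" "y \<notin> {a, b}"
    using a b p s q r adj_irrefl \<open>x \<notin> set s\<close> by auto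
  \<comment> \<open>Otherwise \<open>x\<close>, \<open>a\<close>, \<open>b\<close>, \<open>y\<close>
    would be a cycle in which neither \<open>a\<close> nor \<open>b\<close> completes a triangle on
    \<open>xy\<close>.\<close>
  then have "\<not> adj a b"
    using chordal_common_neighbor[OF \<open>chordal G\<close> xy, of "[a, b]"] a b ay bx adj_sym by auto
  then show False
    using gem_freeD[OF \<open>gem_free G\<close>, of a x y b z] a b ay bx xy xz zy adj_sym by blast
qed

lemma chordal_gem_free_imp_pt:
  assumes "chordal G" "gem_free G"
  shows "axiom_pt (pverts G) (toll_transit G)"
  unfolding axiom_pt_def
proof (intro ballI impI)
  fix u x y z v
  assume d: "distinct [u, x, y, z, v]"
    and T: "x \<in> toll_transit G u y" "z \<in> toll_transit G u y"
      "y \<in> toll_transit G x v" "z \<in> toll_transit G x v"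
    and "toll_transit G x y = {x, y}"
  then have xy: "adj x y" by (simp add: toll_transit_eq_pair_iff)
  have "\<not> adj x z"
    using chordal_gem_free_no_triangle[OF assms d T xy] .
  moreover have "\<not> adj y z"
  proof (rule chordal_gem_free_no_triangle[OF assms])
    \<comment> \<open>The premises are symmetric under exchanging \<open>u\<close> with
      \<open>v\<close> and \<open>x\<close> with \<open>y\<close>.\<close>
    show "distinct [v, y, x, z, u]" using d by auto
    show "y \<in> toll_transit G v x" "z \<in> toll_transit G v x"
      "x \<in> toll_transit G y u" "z \<in> toll_transit G y u"
      using T toll_transit_commute by blast+
  qed (rule adj_sym[OF xy])
  ultimately show "toll_transit G x z \<noteq> {x, z} \<and> toll_transit G y z \<noteq> {y, z}"
    using d by (simp add: toll_transit_eq_pair_iff)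
qed

section \<open>Necessity: gems violate (pt), long induced cycles violate (JC)\<close>

text \<open>In a gem both \<open>b\<close> and \<open>z\<close> are midpoints of induced paths from
  \<open>a\<close> to \<open>c\<close>, and both \<open>c\<close> and \<open>z\<close> of induced
  paths from \<open>b\<close> to \<open>d\<close>, while \<open>b\<close> and \<open>z\<close> are
  adjacent.\<close>

lemma pt_imp_gem_free:
  assumes pt: "axiom_pt (pverts G) (toll_transit G)"
  shows "gem_free G"
  unfolding gem_free_def
proof (intro allI impI, rule ccontr)
  fix a b c d z
  assume e: "{(a, b), (b, c), (c, d), (a, z), (b, z), (c, z), (d, z)} \<subseteq> parcs G"
    and n: "\<not> (adj a c \<or> adj b d \<or> adj a d)"
  then have "distinct [a, b, c, z, d]"
    using adj_irrefl adj_sym by auto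
  moreover have "b \<in> toll_transit G a c" "z \<in> toll_transit G a c"
    "c \<in> toll_transit G b d" "z \<in> toll_transit G b d"
    using e n calculation adj_sym by (auto intro!: toll_transit_middle)
  moreover have "{a, b, c, z, d} \<subseteq> pverts G"
    using e in_arcsD1 in_arcsD2 by auto
  ultimately show False
    using pt e toll_transit_adj unfolding axiom_pt_def by (simp, meson)
qed

text \<open>Axiom (JC) is applied with \<open>u\<close>, \<open>x\<close>, \<open>y\<close>,
  \<open>v\<close> being \<open>c ! 0\<close>, \<open>c ! 3\<close>, \<open>c ! 2\<close>,
  \<open>c ! 1\<close>. It would put \<open>c ! 3\<close> between the adjacent vertices
  \<open>c ! 0\<close> and \<open>c ! 1\<close>.\<close>

lemma JC_imp_chordal:
  assumes JC: "axiom_JC (pverts G) (toll_transit G)"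
  shows "chordal G"
  unfolding chordal_def
proof (intro notI, elim exE conjE)
  fix c
  assume c: "induced_cycle G c" and len: "4 \<le> length c"
  have adj: "adj (c ! i) (c ! j) \<longleftrightarrow> j = Suc i \<or> i = 0 \<and> Suc j = length c"
    if "i < j" "j < length c" for i j
    using c that unfolding induced_cycle_iff by blast
  have c': "distinct c" "set c \<subseteq> pverts G" using c unfolding induced_cycle_iff by blast+
  have verts: "c ! i \<in> pverts G" if "i < 4" for i using c' len that by auto
  have dist: "distinct [c ! 0, c ! 3, c ! 2, c ! 1]"
    using c' len by (simp add: nth_eq_iff_index_eq flip: length_greater_0_conv)
  have e: "adj (c ! 0) (c ! 1)" "adj (c ! 3) (c ! 2)" "adj (c ! 2) (c ! 1)"
    using adj[of 0 1] adj[of 2 3] adj[of 1 2] len adj_sym by auto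
  have n: "\<not> adj (c ! 3) (c ! 1)" "\<not> adj (c ! 0) (c ! 2)"
    using adj[of 1 3] adj[of 0 2] len adj_sym by auto
  \<comment> \<open>This is the cycle without \<open>c ! 1\<close>, traversed backwards from
    \<open>c ! 0\<close> to \<open>c ! 2\<close>.\<close>
  let ?W = "c ! 0 # rev (drop 2 c)"
  have ends: "hd ?W = c ! 0" "last ?W = c ! 2"
    using len by (auto simp: last_rev hd_drop_conv_nth)
  have "successively adj c"
    using adj by (auto simp: successively_conv_nth)
  moreover have "adj (c ! 0) (c ! (length c - 1))"
    using adj[of 0 "length c - 1"] len by auto
  moreover have "hd (rev (drop 2 c)) = c ! (length c - 1)"
  proof -
    have "c \<noteq> []" using len by auto
    then show ?thesis using len last_conv_nth[of c] by (simp add: hd_rev)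
  qed
  ultimately have succ: "successively adj ?W"
    by (simp add: successively_Cons successively_drop del: successively_rev)
  have in_W: "\<exists>j<length c. j \<noteq> 1 \<and> a = c ! j" if a: "a \<in> set ?W" for a
  proof -
    consider "a = c ! 0" | "a \<in> set (drop 2 c)" using a by auto
    then show ?thesis
    proof cases
      case 1
      then show ?thesis using len by (intro exI[of _ 0]) auto
    next
      case 2
      then obtain i where "i < length c - 2" "a = c ! (2 + i)"
        by (auto simp: in_set_conv_nth)
      then show ?thesis by (intro exI[of _ "2 + i"]) auto
    qed
  qed
  have "c ! 3 \<in> toll_transit G (hd ?W) (last ?W)"
  proof (rule toll_transitI[OF succ])
    show "hd ?W \<noteq> last ?W" using dist ends by auto
    have "c ! 3 = drop 2 c ! 1" "1 < length (drop 2 c)" using len by auto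
    then show "c ! 3 \<in> set ?W" by (metis nth_mem list.set_intros(2) set_rev)
    show "a = ?W ! 1" if a: "a \<in> set ?W" "adj (hd ?W) a" for a
    proof -
      obtain j where j: "j < length c" "j \<noteq> 1" "a = c ! j" using in_W a by blast
      \<comment> \<open>Apart from the omitted \<open>c ! 1\<close>, only the last vertex of the
        cycle is adjacent to \<open>c ! 0\<close>.\<close>
      then have "Suc j = length c"
        using a adj[of 0 j] by (cases "j = 0") (auto simp: adj_irrefl)
      then have "j = Suc (Suc (length c - 3))" using len by simp
      then show ?thesis using j(3) len by (simp add: rev_nth)
    qed
    show "a = ?W ! (length ?W - 2)" if a: "a \<in> set ?W" "adj (last ?W) a" for a
    proof -
      obtain j where j: "j < length c" "j \<noteq> 1" "a = c ! j" using in_W a by blast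
      have "adj (c ! 2) a" using a ends by simp
      then have "j = 3"
        using n(2) adj[of 2 j] adj_sym adj_irrefl j
        by (cases "j = 0"; cases "j = 2") (auto simp: numeral_3_eq_3 numeral_2_eq_2)
      moreover obtain n where "length c = n + 4" using len by (metis add.commute le_Suc_ex)
      ultimately show ?thesis using j by (simp add: nth_Cons' rev_nth numeral_3_eq_3)
    qed
  qed (use len in auto)
  moreover have "c ! 2 \<in> toll_transit G (c ! 3) (c ! 1)"
    using e n dist by (intro toll_transit_middle) auto
  moreover have "toll_transit G (c ! 3) (c ! 2) = {c ! 3, c ! 2}"
    using e toll_transit_adj by blast
  ultimately have "c ! 3 \<in> toll_transit G (c ! 0) (c ! 1)"
    using JC[unfolded axiom_JC_def, rule_format, of "c ! 0" "c ! 3" "c ! 2" "c ! 1"] verts dist ends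
    by simp
  then show False
    using toll_transit_adj[OF e(1)] dist by auto
qed

section \<open>Gems and distance-heredity\<close>

lemma vpath_iff:
  "vpath p G \<longleftrightarrow> p \<noteq> [] \<and> set p \<subseteq> pverts G \<and> successively adj p \<and> distinct p"
  by (auto simp: vpath_def vwalk_iff)

text \<open>The induced path \<open>[a, b, c, d]\<close> of a gem is longer than the detour
  \<open>[a, z, d]\<close> through the center.\<close>

lemma distance_hereditary_imp_gem_free:
  assumes DH: "distance_hereditary G"
  shows "gem_free G"
  unfolding gem_free_def
proof (intro allI impI, rule ccontr)
  fix a b c d z
  assume e: "{(a, b), (b, c), (c, d), (a, z), (b, z), (c, z), (d, z)} \<subseteq> parcs G"
    and n: "\<not> (adj a c \<or> adj b d \<or> adj a d)"
  then have d: "distinct [a, b, c, z, d]"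
    using adj_irrefl adj_sym by auto
  have v: "{a, b, c, z, d} \<subseteq> pverts G"
    using e in_arcsD1 in_arcsD2 by auto
  have "induced_path G [a, b, c, d]"
    unfolding induced_path_def vpath_iff
    using e n d v adj_sym by (auto simp: less_Suc_eq adj_irrefl)
  then have "shortest_path G [a, b, c, d]"
    using DH by (simp add: distance_hereditary_def)
  moreover have "vpath [a, z, d] G"
    using e d v adj_sym by (auto simp: vpath_iff)
  ultimately have "vwalk_length [a, b, c, d] \<le> vwalk_length [a, z, d]"
    unfolding shortest_path_def by (metis last.simps list.distinct(1) list.sel(1))
  then show False by simp
qed

lemma induced_path_take: "induced_path G p \<Longrightarrow> 0 < n \<Longrightarrow> induced_path G (take n p)"
  using set_take_subset[of n p]
  by (auto simp: induced_path_def vpath_iff successively_take)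

lemma induced_path_drop:
  assumes "induced_path G p" "n < length p"
  shows "induced_path G (drop n p)"
proof -
  have "j = Suc i \<or> i = Suc j"
    if "i < length p - n" "j < length p - n" "adj (p ! (n + i)) (p ! (n + j))" for i j
  proof -
    have "n + j = Suc (n + i) \<or> n + i = Suc (n + j)"
      using assms that unfolding induced_path_def
      by (metis add.commute less_diff_conv)
    then show ?thesis by simp
  qed
  then show ?thesis
    using assms set_drop_subset[of n p]
    by (auto simp: induced_path_def vpath_iff successively_drop)
qed

text \<open>A shortest counterexample \<open>p\<close> has only geodesic proper subpaths, so a shorter path \<open>q\<close> between
  its ends runs alongside it: \<open>p\<^sub>i\<close> can only be adjacent to \<open>q\<^sub>i\<close> and to its predecessor.  The triangles
  on the first three edges of \<open>p\<close> then form a gem.\<close>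

lemma chordal_gem_free_imp_distance_hereditary:
  assumes "chordal G" "gem_free G"
  shows "distance_hereditary G"
  unfolding distance_hereditary_def
proof
  fix p
  show "induced_path G p \<longrightarrow> shortest_path G p"
  proof (induction p rule: length_induct)
    case (1 p)
    show ?case
    proof (intro impI, rule ccontr)
      assume p: "induced_path G p" and "\<not> shortest_path G p"
      then have vp: "vpath p G" by (simp add: induced_path_def)
      then obtain q where vq: "vpath q G" and q: "hd q = hd p" "last q = last p"
        and lt: "length q < length p"
        using \<open>\<not> shortest_path G p\<close> by (auto simp: shortest_path_def)
      \<comment> \<open>The numbers \<open>k\<close> and \<open>m\<close> are the last positions in
        \<open>p\<close> and \<open>q\<close>, that is, the lengths of the two paths.\<close>
      define k where "k = length p - 1"
      define m where "m = length q - 1"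
      have len: "length p = Suc k" "length q = Suc m"
        using vp vq by (auto simp: k_def m_def vpath_iff)
      have "m < k" using lt len by simp
      have dp: "distinct p" "successively adj p" and dq: "distinct q" "successively adj q"
        and sq: "set p \<subseteq> pverts G" "set q \<subseteq> pverts G"
        using vp vq by (auto simp: vpath_iff)
      have nonempty: "p \<noteq> []" "q \<noteq> []" using len by auto
      have ends: "q ! 0 = p ! 0" "q ! m = p ! k"
        using q len nonempty by (auto simp: hd_conv_nth last_conv_nth)
      have induced: "j = Suc i" if "i < j" "j \<le> k" "adj (p ! i) (p ! j)" for i j
        using p len that unfolding induced_path_def by (metis Suc_lessD le_imp_less_Suc
            less_trans not_less_eq less_asym)
      \<comment> \<open>By induction the proper initial segments of \<open>p\<close>, and below the
        final ones, are geodesics. The bounds count vertices, not edges.\<close>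
      have prefix: "Suc i \<le> length r"
        if "i < k" "vpath r G" "hd r = p ! 0" "last r = p ! i" for i r
      proof -
        have "shortest_path G (take (Suc i) p)"
          using "1" p len that by (intro "1"[rule_format] induced_path_take) auto
        then have "vwalk_length (take (Suc i) p) \<le> vwalk_length r"
          using that len nonempty unfolding shortest_path_def
          by (auto simp: hd_conv_nth last_take_Suc)
        moreover have "r \<noteq> []" using that by (auto simp: vpath_iff)
        ultimately show ?thesis using that len by (cases r) auto
      qed
      have suffix: "Suc k - i \<le> length r"
        if "0 < i" "i \<le> k" "vpath r G" "hd r = p ! i" "last r = p ! k" for i r
      proof -
        have "shortest_path G (drop i p)"
          using "1" p len that by (intro "1"[rule_format] induced_path_drop) auto
        then have "vwalk_length (drop i p) \<le> vwalk_length r"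
          using that len nonempty unfolding shortest_path_def
          by (auto simp: hd_drop_conv_nth last_conv_nth)
        moreover have "r \<noteq> []" using that by (auto simp: vpath_iff)
        ultimately show ?thesis using that len by (cases r) auto
      qed
      have take_q: "vpath (take (Suc j) q) G" "hd (take (Suc j) q) = p ! 0"
          "last (take (Suc j) q) = q ! j" "length (take (Suc j) q) = Suc j"
          "set (take (Suc j) q) \<subseteq> set q"
        and drop_q: "vpath (drop j q) G" "hd (drop j q) = q ! j"
          "last (drop j q) = p ! k" "length (drop j q) = Suc m - j" "set (drop j q) \<subseteq> set q"
        if "j \<le> m" for j
        using that vq len nonempty ends set_take_subset[of "Suc j" q] set_drop_subset[of j q]
        by (auto simp: vpath_iff successively_take successively_drop hd_conv_nth last_take_Suc
            hd_drop_conv_nth last_conv_nth simp del: take_Suc)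
      \<comment> \<open>If \<open>q\<close> met \<open>p\<close> at an inner vertex, its two parts
        would be at least as long as those of \<open>p\<close>, against
        \<open>m < k\<close>.\<close>
      have disj: "p ! i \<noteq> q ! j" if "0 < i" "i < k" "j \<le> m" for i j
      proof
        assume "p ! i = q ! j"
        then have "Suc i \<le> Suc j" "Suc k - i \<le> Suc m - j"
          using prefix[of i "take (Suc j) q"] suffix[of i "drop j q"] take_q[of j] drop_q[of j] that
          by auto
        then show False using that \<open>m < k\<close> by linarith
      qed
      \<comment> \<open>The same count with one additional edge on each part of
        \<open>q\<close>.\<close>
      have near: "i \<le> Suc j \<and> j \<le> i" if "0 < i" "i < k" "j \<le> m" "adj (p ! i) (q ! j)" for i j
      proof -
        have notin: "p ! i \<notin> set q"
          using disj that len by (metis in_set_conv_nth less_Suc_eq_le)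
        have pi: "p ! i \<in> pverts G" using sq len that by auto
        have "vpath (take (Suc j) q @ [p ! i]) G"
          using take_q[of j] that notin pi adj_sym
          by (auto simp: vpath_iff successively_append_iff simp del: take_Suc)
        then have "Suc i \<le> Suc (Suc j)"
          using prefix[of i "take (Suc j) q @ [p ! i]"] take_q[of j] that nonempty by auto
        moreover have "vpath (p ! i # drop j q) G"
          using drop_q[of j] that notin pi
          by (auto simp: vpath_iff successively_Cons)
        then have "Suc k - i \<le> Suc (Suc m - j)"
          using suffix[of i "p ! i # drop j q"] drop_q[of j] that nonempty len by auto
        ultimately show ?thesis using that \<open>m < k\<close> by linarith
      qed
      \<comment> \<open>For \<open>m = 0\<close> the ends of \<open>p\<close> would coincide, for
        \<open>m = 1\<close> they would be joined by a chord of \<open>p\<close>.\<close>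
      have "m \<noteq> 0"
        using ends nth_eq_iff_index_eq[OF dp(1), of 0 k] len \<open>m < k\<close> by (intro notI) auto
      moreover have "m \<noteq> 1"
      proof
        assume "m = 1"
        then have "adj (p ! 0) (p ! k)"
          using successively_nth[OF dq(2), of 0] ends len by auto
        then show False using induced[of 0 k] \<open>m < k\<close> \<open>m = 1\<close> by auto
      qed
      ultimately have "2 \<le> m" by simp
      define q' where "q' = butlast (tl q)"
      have q': "q = p ! 0 # q' @ [p ! k]"
      proof -
        have "tl q \<noteq> []" using \<open>2 \<le> m\<close> len by (cases q) auto
        then have "q = hd q # butlast (tl q) @ [last q]"
          using nonempty by (metis append_butlast_last_id hd_Cons_tl last_tl)
        then show ?thesis
          using q len nonempty by (simp add: q'_def hd_conv_nth last_conv_nth)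
      qed
      have "q' \<noteq> []" using q' \<open>2 \<le> m\<close> len by auto
      have in_q': "\<exists>j. 0 < j \<and> j < m \<and> z = q ! j" if z: "z \<in> set q'" for z
      proof -
        obtain l where "l < length q'" "z = q' ! l" using z by (auto simp: in_set_conv_nth)
        then show ?thesis
          using q' arg_cong[OF q', of length] len
          by (intro exI[of _ "Suc l"]) (simp add: nth_append)
      qed
      \<comment> \<open>Without the edge from \<open>p ! i\<close> to \<open>p ! Suc i\<close>, the
        closed walk formed by \<open>p\<close> and \<open>q\<close> still connects its ends. The
        third vertex of the triangle is not on \<open>p\<close>, which is induced, so it is an inner
        vertex of \<open>q\<close>.\<close>
      have triangle: "\<exists>j. 0 < j \<and> j < m \<and> adj (p ! i) (q ! j) \<and> adj (p ! Suc i) (q ! j)"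
        if i: "i < k" for i
      proof -
        define p1 where "p1 = take i p"
        define p2 where "p2 = drop (Suc (Suc i)) p"
        have p12: "p = p1 @ p ! i # p ! Suc i # p2"
          using i len unfolding p1_def p2_def by (simp add: Cons_nth_drop_Suc)
        have xy: "adj (p ! i) (p ! Suc i)"
          using successively_nth[OF dp(2)] i len by simp
        \<comment> \<open>From \<open>p ! i\<close> back to the start of \<open>p\<close>, through
          the interior of \<open>q\<close>, and from the end of \<open>p\<close> back to
          \<open>p ! Suc i\<close>. Either outer part may be empty, and then the edge starts or ends
          at an end of \<open>p\<close>.\<close>
        let ?w = "rev p1 @ q' @ rev p2"
        have lp1: "p1 \<noteq> [] \<Longrightarrow> hd p1 = p ! 0"
          and lp2: "p2 \<noteq> [] \<Longrightarrow> last p2 = p ! k"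
          using i len nonempty last_conv_nth[of p] by (auto simp: p1_def p2_def hd_conv_nth)
        have sp: "successively adj (p1 @ p ! i # p ! Suc i # p2)" "distinct (p1 @ p ! i # p ! Suc i # p2)"
          using dp p12 by auto
        have sq': "successively adj (p ! 0 # q' @ [p ! k])" "distinct (p ! 0 # q' @ [p ! k])"
          using dq q' by auto
        have "successively adj p1" "successively adj p2" "successively adj q'"
          and q'_ends: "adj (p ! 0) (hd q')" "adj (last q') (p ! k)"
          using sp sq' \<open>q' \<noteq> []\<close> by (auto simp: successively_append_iff successively_Cons)
        then have "successively adj ?w"
          using lp1 lp2 \<open>q' \<noteq> []\<close>
          by (cases "p1 = []"; cases "p2 = []")
            (simp_all add: successively_append_iff last_rev hd_rev del: successively_rev)
        moreover have "p1 = [] \<Longrightarrow> i = 0" "p2 = [] \<Longrightarrow> Suc i = k"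
          using i len by (auto simp: p1_def p2_def)
        then have "adj (p ! i) (hd ?w)" "adj (last ?w) (p ! Suc i)"
          using sp \<open>q' \<noteq> []\<close> adj_sym q'_ends
          by (cases "p1 = []"; cases "p2 = []";
              simp add: successively_append_iff successively_Cons last_rev hd_rev)+
        moreover have "p ! i \<notin> set q'" "p ! Suc i \<notin> set q'"
        proof -
          show "p ! i \<notin> set q'"
          proof
            assume z: "p ! i \<in> set q'"
            then obtain j where "j < m" "p ! i = q ! j" using in_q' by blast
            then show False using disj[of i j] i z sq'(2) by (cases "i = 0") auto
          qed
          show "p ! Suc i \<notin> set q'"
          proof
            assume z: "p ! Suc i \<in> set q'"
            then obtain j where "j < m" "p ! Suc i = q ! j" using in_q' by blast
            then show False using disj[of "Suc i" j] i z sq'(2) by (cases "Suc i = k") auto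
          qed
        qed
        ultimately obtain z where z: "z \<in> set ?w" "adj (p ! i) z" "adj z (p ! Suc i)"
          using chordal_common_neighbor[OF \<open>chordal G\<close> xy, of ?w] sp \<open>q' \<noteq> []\<close> by auto
        have "z \<notin> set p1"
        proof
          assume "z \<in> set p1"
          then obtain l where "l < i" "z = p ! l" by (auto simp: p1_def in_set_conv_nth)
          then show False using induced[of l "Suc i"] z i by auto
        qed
        moreover have "z \<notin> set p2"
        proof
          assume "z \<in> set p2"
          then obtain l where "l < length p2" "z = p2 ! l" by (auto simp: in_set_conv_nth)
          then have "Suc (Suc i) + l \<le> k" "z = p ! (Suc (Suc i) + l)"
            using i len by (auto simp: p2_def)
          then show False using induced[of i "Suc (Suc i) + l"] z by auto
        qed
        ultimately have "z \<in> set q'" using z by auto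
        then show ?thesis using in_q' z adj_sym by blast
      qed
      have "3 \<le> k" using \<open>2 \<le> m\<close> \<open>m < k\<close> by simp
      have path: "adj (p ! 0) (p ! 1)" "adj (p ! 1) (p ! 2)" "adj (p ! 2) (p ! 3)"
        using successively_nth[OF dp(2), of 0] successively_nth[OF dp(2), of 1]
          successively_nth[OF dp(2), of 2] \<open>3 \<le> k\<close> len
        by (auto simp: numeral_2_eq_2 numeral_3_eq_3)
      have nonadj: "\<not> adj (p ! 0) (p ! 2)" "\<not> adj (p ! 1) (p ! 3)" "\<not> adj (p ! 0) (p ! 3)"
        using induced[of 0 2] induced[of 1 3] induced[of 0 3] \<open>3 \<le> k\<close> by auto
      have near1: "j = 1" if "0 < j" "j < m" "adj (p ! 1) (q ! j)" for j
        using near[of 1 j] that \<open>3 \<le> k\<close> by auto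
      \<comment> \<open>The triangles on the first two edges both contain \<open>p ! 1\<close>, so
        \<open>near1\<close> gives them the same third vertex \<open>q ! 1\<close>.\<close>
      have q1: "adj (p ! 0) (q ! 1)" "adj (p ! 1) (q ! 1)" "adj (p ! 2) (q ! 1)"
        using triangle[of 0] triangle[of 1] near1 \<open>3 \<le> k\<close> by (auto simp: numeral_2_eq_2)
      obtain j where j: "0 < j" "j < m" "adj (p ! 2) (q ! j)" "adj (p ! 3) (q ! j)"
        using triangle[of 2] \<open>3 \<le> k\<close> by (auto simp: numeral_3_eq_3)
      then have "j \<le> 2" using near[of 2 j] \<open>3 \<le> k\<close> by auto
      note gem = gem_freeD[OF \<open>gem_free G\<close>]
      show False
      \<comment> \<open>If \<open>q ! 1\<close> is also adjacent to \<open>p ! 3\<close>, it is the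
        center of a gem over the first four vertices of \<open>p\<close>. Otherwise the third
        triangle uses \<open>q ! 2\<close>, and \<open>p ! 2\<close> is the center of a gem over
        \<open>p ! 1\<close>, \<open>q ! 1\<close>, \<open>q ! 2\<close>,
        \<open>p ! 3\<close>.\<close>
      proof (cases "adj (p ! 3) (q ! 1)")
        case True
        then show ?thesis using gem[OF path q1] nonadj by blast
      next
        case False
        then have "j = 2" using j \<open>j \<le> 2\<close> by (cases "j = 1") auto
        then have "\<not> adj (p ! 1) (q ! 2)" using near1[of 2] j by auto
        moreover have "adj (q ! 1) (q ! 2)"
          using successively_nth[OF dq(2), of 1] j \<open>j = 2\<close> len by (simp add: numeral_2_eq_2)
        ultimately show ?thesis
          using gem[of "p ! 1" "q ! 1" "q ! 2" "p ! 3" "p ! 2"] q1 path nonadj j \<open>j = 2\<close> False adj_sym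
          by blast
      qed
    qed
  qed
qed

end

theorem theorem11:
  fixes G :: "'a pair_pre_digraph"
  assumes "pair_graph G"
  shows "axiom_JC (pverts G) (toll_transit G) \<and> axiom_pt (pverts G) (toll_transit G)
    \<longleftrightarrow> ptolemaic G"
proof -
  interpret pair_graph G by fact
  show ?thesis
    unfolding ptolemaic_def
    using JC_imp_chordal pt_imp_gem_free chordal_gem_free_imp_distance_hereditary
      distance_hereditary_imp_gem_free chordal_imp_JC chordal_gem_free_imp_pt
    by blast
qed

end
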